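(* Suppose that $|q|<1$. Then for all integers $r\ge 0$ and $n\ge 1$: $$\beta_n^{(r)}=\begin{cases}\displaystyle -n\sum_{k=0}^{+\infty}q^k[k]^{n-1}+(1-q)^{-n} & \text{if } r=0,\\[3mm] \displaystyle -n\sum_{k=0}^{+\infty}q^{(r+1)k}[k]^{n-1}+r(1-q)\sum_{k=0}^{+\infty}q^{rk}[k]^n & \text{if } r\ge 1.\end{cases}$$
   Context: Here $q$ is a positive real number, $q\neq 1$ (so the hypothesis means $0<q<1$), and $[X]:=\frac{q^X-1}{q-1}$. For integers $n\ge 0$ let $$\eta_n(X):=(q-1)^{-n}\sum_{k=0}^{n}(-1)^{n-k}\binom{n}{k}\frac{k}{[k]}\,q^{kX},$$ with the convention $\frac{k}{[k]}=1$ for $k=0$. The extended Carlitz $q$-Bernoulli polynomials $\beta_n^{(r)}(X)$ ($r,n\ge 0$ integers) are defined recursively by $\beta_n^{(0)}(X):=\eta_n(X)$ and $$\beta_n^{(r+1)}(X):=q^{-X}\left(\beta_n^{(r)}(X)+(q-1)\beta_{n+1}^{(r)}(X)\right),$$ and the extended Carlitz $q$-Bernoulli numbers of order $r$ are $\beta_n^{(r)}:=\beta_n^{(r)}(0)$. The convention $[k]^0=1$ (also for $k=0$) is used. *)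

theory Defs
  imports Complex_Main
begin

text \<open>
  The parameter \<open>q\<close> and the variable \<open>X\<close> are real; \<open>q ^ X\<close> is rendered by \<open>powr\<close>, which is the
  usual real power since \<open>q > 0\<close> wherever these notions are used.
\<close>

definition q_bracket :: "real \<Rightarrow> real \<Rightarrow> real"
  where "q_bracket q X = (q powr X - 1) / (q - 1)"

text \<open>The factor \<open>k / [k]\<close>, which by convention is \<open>1\<close> (and not \<open>0 / 0 = 0\<close>) for \<open>k = 0\<close>.\<close>

definition q_ratio :: "real \<Rightarrow> nat \<Rightarrow> real"
  where "q_ratio q k = (if k = 0 then 1 else real k / q_bracket q (real k))"

definition q_eta :: "real \<Rightarrow> nat \<Rightarrow> real \<Rightarrow> real"
  where "q_eta q n X =
    (q - 1) powi (- int n) *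
    (\<Sum>k=0..n. (-1) ^ (n - k) * real (n choose k) * q_ratio q k * q powr (real k * X))"

text \<open>\<open>carlitz_poly q r n X\<close> is \<open>\<beta>\<^sub>n\<^bsup>(r)\<^esup>(X)\<close>: first the order \<open>r\<close>, then the index \<open>n\<close>.\<close>

primrec carlitz_poly :: "real \<Rightarrow> nat \<Rightarrow> nat \<Rightarrow> real \<Rightarrow> real"
  where
    "carlitz_poly q 0 = (\<lambda>n X. q_eta q n X)"
  | "carlitz_poly q (Suc r) =
      (\<lambda>n X. q powr (- X) * (carlitz_poly q r n X + (q - 1) * carlitz_poly q r (n + 1) X))"

definition carlitz_number :: "real \<Rightarrow> nat \<Rightarrow> nat \<Rightarrow> real"
  where "carlitz_number q r n = carlitz_poly q r n 0"

end

theory Submission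
  imports Defs
begin

text \<open>
  At \<open>X = 0\<close>, expanding \<open>1 / (1 - q\<^sup>k)\<close> as a geometric series and using
  \<open>k (n choose k) = n (n - 1 choose k - 1)\<close> collapses the sum over \<open>k\<close> by the binomial
  theorem, which settles order \<open>0\<close>. Since \<open>1 + (q - 1)[k] = q\<^sup>k\<close>, the series
  \<open>S(r,n) = \<Sum>\<^sub>k q\<^bsup>rk\<^esup>[k]\<^sup>n\<close> satisfy \<open>S(r,n) + (q - 1) S(r,n+1) = S(r+1,n)\<close>, which is the
  recursion of the numbers in \<open>r\<close>; induction on the order finishes.
\<close>

lemma q_bracket_of_nat:
  assumes "0 < q"
  shows "q_bracket q (real k) = (q ^ k - 1) / (q - 1)"
  using assms by (simp add: q_bracket_def powr_realpow)

lemma one_plus_q_bracket: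
  assumes "0 < q" "q \<noteq> 1"
  shows "1 + (q - 1) * q_bracket q (real k) = q ^ k"
  using assms by (simp add: q_bracket_of_nat)

lemma abs_q_bracket_le:
  assumes "0 < q" "q < 1"
  shows "\<bar>q_bracket q (real k)\<bar> \<le> 1 / (1 - q)"
proof -
  have "0 \<le> 1 - q ^ k" "1 - q ^ k \<le> 1"
    using assms by (simp_all add: power_le_one)
  moreover have "q_bracket q (real k) = (1 - q ^ k) / (1 - q)"
    using assms minus_divide_divide[of "1 - q ^ k" "1 - q"] by (simp add: q_bracket_of_nat)
  ultimately show ?thesis
    using assms by (simp add: abs_divide divide_right_mono)
qed

text \<open>The brackets are bounded by \<open>1 / (1 - q)\<close> uniformly in \<open>k\<close>, so
  a geometric series of ratio \<open>q ^ r\<close> dominates; \<open>r \<ge> 1\<close> makes this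
  ratio less than 1.\<close>

lemma summable_q_bracket_power:
  assumes "0 < q" "q < 1" "r \<ge> 1"
  shows "summable (\<lambda>k. q ^ (r * k) * q_bracket q (real k) ^ n)"
proof (rule summable_comparison_test')
  show "summable (\<lambda>k. (q ^ r) ^ k * (1 / (1 - q)) ^ n)"
    using assms by (intro summable_mult2 summable_geometric) (simp add: power_less_one_iff)
next
  fix k
  have "\<bar>q_bracket q (real k)\<bar> ^ n \<le> (1 / (1 - q)) ^ n"
    using abs_q_bracket_le[OF assms(1,2)] by (intro power_mono) auto
  then show "norm (q ^ (r * k) * q_bracket q (real k) ^ n) \<le> (q ^ r) ^ k * (1 / (1 - q)) ^ n"
    using assms by (simp add: abs_mult power_abs power_mult mult_left_mono)
qed

text \<open>This is S(r,n) of the overview. It is meaningful only for \<open>r \<ge> 1\<close>: at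
  \<open>r = 0\<close> the terms tend to \<open>(1 / (1 - q)) ^ n\<close>, which is not 0.\<close>

definition q_bracket_series :: "real \<Rightarrow> nat \<Rightarrow> nat \<Rightarrow> real"
  where "q_bracket_series q r n = (\<Sum>k. q ^ (r * k) * q_bracket q (real k) ^ n)"

lemma q_bracket_series_Suc_exponent:
  assumes "0 < q" "q < 1" "r \<ge> 1"
  shows "q_bracket_series q (Suc r) n
    = q_bracket_series q r n + (q - 1) * q_bracket_series q r (Suc n)"
proof -
  let ?f = "\<lambda>n k. q ^ (r * k) * q_bracket q (real k) ^ n"
  have "q ^ (Suc r * k) * q_bracket q (real k) ^ n = ?f n k + (q - 1) * ?f (Suc n) k" for k
  proof -
    have "q ^ (Suc r * k) * q_bracket q (real k) ^ n = ?f n k * q ^ k"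
      by (simp add: power_add)
    also have "\<dots> = ?f n k * (1 + (q - 1) * q_bracket q (real k))"
      using assms by (subst one_plus_q_bracket) auto
    finally show ?thesis by (simp add: algebra_simps)
  qed
  moreover have "?f n' sums q_bracket_series q r n'" for n'
    unfolding q_bracket_series_def by (intro summable_sums summable_q_bracket_power assms)
  then have "(\<lambda>k. ?f n k + (q - 1) * ?f (Suc n) k)
      sums (q_bracket_series q r n + (q - 1) * q_bracket_series q r (Suc n))"
    by (intro sums_add sums_mult)
  ultimately show ?thesis
    unfolding q_bracket_series_def[of q "Suc r"] by (simp only: sums_unique[symmetric])
qed

lemma carlitz_number_Suc_order:
  assumes "0 < q"
  shows "carlitz_number q (Suc r) n
    = carlitz_number q r n + (q - 1) * carlitz_number q r (Suc n)"
  using assms by (simp add: carlitz_number_def)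

text \<open>A geometric series of ratio \<open>q ^ Suc k\<close>. The successor excludes index 0,
  where the ratio would be 1 and \<open>q_ratio\<close> is 1 by convention.\<close>

lemma sums_q_ratio_Suc:
  assumes "0 < q" "q < 1"
  shows "(\<lambda>i. (1 - q) * real (Suc k) * (q ^ Suc k) ^ i) sums q_ratio q (Suc k)"
proof -
  have "q ^ Suc k < 1"
    using assms by (intro power_Suc_less_one) auto
  then have "(\<lambda>i. (q ^ Suc k) ^ i) sums (1 / (1 - q ^ Suc k))"
    using assms by (intro geometric_sums) simp
  then have "(\<lambda>i. (1 - q) * real (Suc k) * (q ^ Suc k) ^ i)
      sums ((1 - q) * real (Suc k) * (1 / (1 - q ^ Suc k)))"
    by (rule sums_mult)
  also have "(1 - q) * real (Suc k) * (1 / (1 - q ^ Suc k)) = q_ratio q (Suc k)"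
    using assms \<open>q ^ Suc k < 1\<close>
    unfolding q_ratio_def q_bracket_of_nat[OF assms(1)]
    by (simp del: power_Suc add: divide_simps) (simp add: algebra_simps)
  finally show ?thesis .
qed

lemma carlitz_number_order_0:
  assumes "0 < q" "q < 1"
  shows "carlitz_number q 0 (Suc m)
    = - real (Suc m) * q_bracket_series q 1 m + (1 - q) powi (- int (Suc m))"
proof -
  \<comment> \<open>The term of index 0 is split off and the others shifted by one;
    \<open>?S\<close> collects the terms that have a geometric expansion.\<close>
  let ?c = "\<lambda>k. (-1) ^ (m - k) * real (Suc m choose Suc k)"
  let ?S = "\<Sum>k\<le>m. ?c k * q_ratio q (Suc k)"
  \<comment> \<open>Interchange of summations: the series over \<open>i\<close> moves outside the
    finite sum over \<open>k\<close>.\<close>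
  have "(\<lambda>i. \<Sum>k\<le>m. ?c k * ((1 - q) * real (Suc k) * (q ^ Suc k) ^ i)) sums ?S"
    using assms by (intro sums_sum sums_mult sums_q_ratio_Suc)
  moreover have "(\<Sum>k\<le>m. ?c k * ((1 - q) * real (Suc k) * (q ^ Suc k) ^ i))
      = (1 - q) * real (Suc m) * (q - 1) ^ m * (q ^ (1 * i) * q_bracket q (real i) ^ m)" for i
  proof -
    have "?c k * ((1 - q) * real (Suc k) * (q ^ Suc k) ^ i)
        = (1 - q) * real (Suc m) * q ^ i * (real (m choose k) * (q ^ i) ^ k * (-1) ^ (m - k))" for k
    proof -
      have "real (Suc m choose Suc k) * real (Suc k) = real (Suc m) * real (m choose k)"
        using Suc_times_binomial[of k m] by (metis of_nat_mult mult.commute)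
      moreover have "(q ^ Suc k) ^ i = q ^ i * (q ^ i) ^ k"
        by (simp add: power_mult_distrib flip: power_mult) (simp add: mult.commute)
      ultimately show ?thesis by (simp del: of_nat_Suc power_Suc binomial_Suc_Suc)
    qed
    then have "(\<Sum>k\<le>m. ?c k * ((1 - q) * real (Suc k) * (q ^ Suc k) ^ i))
        = (1 - q) * real (Suc m) * q ^ i
          * (\<Sum>k\<le>m. real (m choose k) * (q ^ i) ^ k * (-1) ^ (m - k))"
      by (simp only: sum_distrib_left)
    also have "\<dots> = (1 - q) * real (Suc m) * q ^ i * (q ^ i - 1) ^ m"
      by (simp add: binomial_ring[of "q ^ i" "-1" m, simplified])
    also have "q ^ i - 1 = (q - 1) * q_bracket q (real i)"
      using one_plus_q_bracket[of q i] assms by linarith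
    finally show ?thesis by (simp add: power_mult_distrib)
  qed
  ultimately have "(\<lambda>i. (1 - q) * real (Suc m) * (q - 1) ^ m
      * (q ^ (1 * i) * q_bracket q (real i) ^ m)) sums ?S"
    by simp
  moreover have "(\<lambda>i. (1 - q) * real (Suc m) * (q - 1) ^ m
      * (q ^ (1 * i) * q_bracket q (real i) ^ m))
      sums ((1 - q) * real (Suc m) * (q - 1) ^ m * q_bracket_series q 1 m)"
    unfolding q_bracket_series_def
    using summable_q_bracket_power[OF assms, of 1 m] by (intro sums_mult summable_sums) simp
  ultimately have S: "?S = (1 - q) * real (Suc m) * (q - 1) ^ m * q_bracket_series q 1 m"
    by (rule sums_unique2)
  \<comment> \<open>The summand \<open>(-1) ^ Suc m\<close> is the term of index 0; it becomes the
    extra power of \<open>1 - q\<close>. In \<open>?S\<close>, the factor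
    \<open>(1 - q) * (q - 1) ^ m\<close> is \<open>- (q - 1) ^ Suc m\<close>, whence the minus
    sign.\<close>
  have "carlitz_number q 0 (Suc m) = inverse ((q - 1) ^ Suc m) * ((-1) ^ Suc m + ?S)"
    using assms unfolding carlitz_number_def carlitz_poly.simps q_eta_def atLeast0AtMost
      sum.atMost_Suc_shift power_int_minus power_int_of_nat
    by (simp add: q_ratio_def[of _ 0] del: power_Suc of_nat_Suc binomial_Suc_Suc)
  also have "\<dots> = - real (Suc m) * q_bracket_series q 1 m + inverse ((q - 1) ^ Suc m) * (-1) ^ Suc m"
    unfolding S using assms by (simp add: divide_simps) (simp add: algebra_simps)
  also have "inverse ((q - 1) ^ Suc m) * (-1) ^ Suc m = inverse ((1 - q) ^ Suc m)"
    using power_mult_distrib[of "-1" "1 - q" "Suc m"] by (simp add: divide_simps)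
  finally show ?thesis by (simp only: power_int_minus power_int_of_nat)
qed

text \<open>The induction starts at order 1, since order 0 carries an extra power of
  \<open>1 - q\<close> and has a different shape.\<close>

lemma carlitz_number_Suc_order_eq:
  assumes "0 < q" "q < 1"
  shows "carlitz_number q (Suc r) (Suc m)
    = - real (Suc m) * q_bracket_series q (Suc (Suc r)) m
      + real (Suc r) * (1 - q) * q_bracket_series q (Suc r) (Suc m)"
proof (induction r arbitrary: m)
  case 0
  let ?A = "(1 - q) powi (- int (Suc m))" and ?B = "(1 - q) powi (- int (Suc (Suc m)))"
  \<comment> \<open>The extra powers from order 0 enter the recursion as
    \<open>?A + (q - 1) * ?B\<close>, which therefore vanishes.\<close>
  have "?A = (1 - q) * ?B"
    using assms by (simp only: power_int_minus power_int_of_nat) (simp add: divide_simps)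
  then show ?case
    unfolding carlitz_number_Suc_order[OF assms(1)] carlitz_number_order_0[OF assms]
      q_bracket_series_Suc_exponent[OF assms, of "Suc 0", simplified] One_nat_def
    by (simp add: algebra_simps)
next
  case (Suc r)
  \<comment> \<open>The series recursion is used for both sums. As the index factor grows from
    \<open>Suc m\<close> to \<open>Suc (Suc m)\<close>, one further copy of
    \<open>(1 - q) * q_bracket_series q (Suc (Suc r)) (Suc m)\<close> is left over, raising the
    coefficient by one.\<close>
  show ?case
    unfolding carlitz_number_Suc_order[OF assms(1), of "Suc r"] Suc.IH
      q_bracket_series_Suc_exponent[OF assms, of "Suc (Suc r)", simplified]
      q_bracket_series_Suc_exponent[OF assms, of "Suc r" "Suc m", simplified]
    by (simp add: algebra_simps)
qed

text \<open>Summability is asserted along with each formula, because an infinite sum in HOL denotes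
  some real even when the series diverges.\<close>

theorem theorem2p19:
  fixes q :: real and r n :: nat
  assumes "0 < q" and "q \<noteq> 1" and "\<bar>q\<bar> < 1" and "n \<ge> 1"
  shows "if r = 0
    then
      summable (\<lambda>k::nat. q ^ k * q_bracket q (real k) ^ (n - 1)) \<and>
      carlitz_number q r n =
        - real n * (\<Sum>k::nat. q ^ k * q_bracket q (real k) ^ (n - 1))
        + (1 - q) powi (- int n)
    else
      summable (\<lambda>k::nat. q ^ ((r + 1) * k) * q_bracket q (real k) ^ (n - 1)) \<and>
      summable (\<lambda>k::nat. q ^ (r * k) * q_bracket q (real k) ^ n) \<and>
      carlitz_number q r n =
        - real n * (\<Sum>k::nat. q ^ ((r + 1) * k) * q_bracket q (real k) ^ (n - 1))
        + real r * (1 - q) * (\<Sum>k::nat. q ^ (r * k) * q_bracket q (real k) ^ n)"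
proof -
  have q: "0 < q" "q < 1"
    using assms by auto
  obtain m where n: "n = Suc m"
    using assms(4) by (cases n) auto
  show ?thesis
  proof (cases r)
    case 0
    then show ?thesis
      using summable_q_bracket_power[OF q, of 1 m] carlitz_number_order_0[OF q, of m]
      by (simp add: n q_bracket_series_def)
  next
    case (Suc s)
    then show ?thesis
      using summable_q_bracket_power[OF q, of "r + 1" m] summable_q_bracket_power[OF q, of r n]
        carlitz_number_Suc_order_eq[OF q, of s m]
      by (simp add: n q_bracket_series_def)
  qed
qed

end
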